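(* Let $D\subseteq\mathbb{R}^n$ be an open convex set and let $F: D\to\mathbb{R}^n$ be sufficiently Fréchet differentiable in $D$. Let $\alpha\in D$ satisfy $F(\alpha)=0$, and suppose that $F'(X)$ is continuous and nonsingular in $D$. Then, for $X^{(0)}$ sufficiently close to $\alpha$, the sequence $\{X^{(k)}\}_{k\ge 0}$ obtained by the iteration $$Y^{(k)}=X^{(k)}-[F'(X^{(k)})]^{-1}F(X^{(k)}),$$ $$X^{(k+1)}=X^{(k)}-\tfrac12\left(3I-[F'(X^{(k)})]^{-1}F'(Y^{(k)})\right)[F'(X^{(k)})]^{-1}F(X^{(k)})$$ converges to $\alpha$ with order three.
   Context: $F'(X)$ denotes the Jacobian matrix (Fréchet derivative) of $F$ at $X$, and $I$ is the $n\times n$ identity matrix. "Sufficiently Fréchet differentiable" means that $F$ has continuous Fréchet derivatives in $D$ of all orders needed for local Taylor expansions at $\alpha$ (expansions of $F$ with remainder $O(\|H\|^6)$ are used, so $F\in C^6(D)$ is an adequate reading). "For $X^{(0)}$ sufficiently close to $\alpha$" means: there is a neighborhood of $\alpha$ such that the iterates are well defined and the conclusion holds for every $X^{(0)}$ in that neighborhood. With $E^{(k)}=X^{(k)}-\alpha$, "converges to $\alpha$ with order $p$" means that $X^{(k)}\to\alpha$ and there is a constant $C$ with $\|E^{(k+1)}\|\le C\|E^{(k)}\|^p$ for all $k$ (order at least $p$). *)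

theory Defs
  imports "HOL-Analysis.Analysis"
begin

text \<open>
  \<open>f\<close> has continuous Frechet derivatives of all orders up to \<open>k\<close> on \<open>S\<close> (meant for open \<open>S\<close>).
  The iterated derivative of order \<open>j\<close> takes values in a space of multilinear maps, a type that
  depends on \<open>j\<close>, so the recursion goes through the functions \<open>x \<mapsto> f'(x) v\<close> for fixed \<open>v\<close>.
  The domain is finite-dimensional, so \<open>x \<mapsto> f'(x)\<close> is continuous (resp. Frechet differentiable)
  for the operator norm iff \<open>x \<mapsto> f'(x) v\<close> is so for every \<open>v\<close>.
\<close>
fun Ck_on :: "nat \<Rightarrow> ('a::euclidean_space \<Rightarrow> 'b::real_normed_vector) \<Rightarrow> 'a set \<Rightarrow> bool" where
  "Ck_on 0 f S \<longleftrightarrow> continuous_on S f"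
| "Ck_on (Suc k) f S \<longleftrightarrow>
     (\<forall>x\<in>S. f differentiable (at x)) \<and>
     (\<forall>v. Ck_on k (\<lambda>x. frechet_derivative f (at x) v) S)"

text \<open>Convergence with order at least \<open>p\<close>; the constant may depend on the sequence.\<close>
definition converges_with_order :: "(nat \<Rightarrow> 'a::real_normed_vector) \<Rightarrow> 'a \<Rightarrow> nat \<Rightarrow> bool" where
  "converges_with_order X a p \<longleftrightarrow>
     X \<longlonglongrightarrow> a \<and> (\<exists>C. \<forall>k. norm (X (Suc k) - a) \<le> C * norm (X k - a) ^ p)"

end

theory Submission
  imports Defs
begin

text \<open>
  Write \<open>J x\<close> for the Jacobian, \<open>e = x - \<alpha>\<close> for the error, \<open>u = (J x)\<^sup>-\<^sup>1 (F x)\<close> for the Newton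
  correction and \<open>y = x - u\<close> for the Newton iterate, so that \<open>y - \<alpha> = e - u\<close>. Multiplying the
  error of the new iterate \<open>x'\<close> by \<open>J x\<close> removes all inverses and gives the exact identity

  \<open>J x (x' - \<alpha>) = - (F x - (J x e + J \<alpha> e)/2) + ((J x - J \<alpha>) (y - \<alpha>) + (J y - J \<alpha>) u) / 2\<close>.

  Each of the three terms is of third order in \<open>e\<close>. The first is the error of the trapezoidal rule
  for \<open>F x - F \<alpha>\<close>, the integral of \<open>t \<mapsto> J(\<alpha> + t e) e\<close> over the unit interval. In the second, \<open>J\<close>
  is Lipschitz and the Newton error \<open>y - \<alpha>\<close> is quadratic. In the third, \<open>J y - J \<alpha>\<close> is of the
  order of \<open>y - \<alpha>\<close>, hence quadratic, and \<open>u\<close> is of the order of \<open>e\<close>.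

  The trapezoidal estimate is \<open>C3_trapezoidal_rule\<close>, the Newton error is
  \<open>newton_residual_quadratic\<close> with \<open>newton_step_error\<close>, and \<open>corrected_step_error\<close> combines them
  by the identity above. Since \<open>J \<alpha>\<close> is nonsingular, \<open>J x\<close> is bounded below uniformly near \<open>\<alpha>\<close>
  (\<open>invertible_locally_bounded_below\<close>), which turns the bound on \<open>J x (x' - \<alpha>)\<close> into one on
  \<open>x' - \<alpha>\<close>. On a small enough ball the resulting cubic bound is a contraction, so the ball is
  invariant and the iterates converge (\<open>cubic_contraction_converges\<close>).
\<close>

section \<open>Smooth functions and their directional derivatives\<close>

lemma Ck_on_SucD: "Ck_on (Suc k) f S \<Longrightarrow> Ck_on k f S"
proof (induction k arbitrary: f)
  case 0
  then show ?case
    by (auto intro!: continuous_at_imp_continuous_on differentiable_imp_continuous_within)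
next
  case (Suc k)
  then show ?case
    by (metis Ck_on.simps(2))
qed

lemma Ck_on_antimono: "k \<le> m \<Longrightarrow> Ck_on m f S \<Longrightarrow> Ck_on k f S"
  by (induction rule: inc_induct) (auto intro: Ck_on_SucD simp del: Ck_on.simps)

text \<open>
  \<^const>\<open>Ck_on\<close> controls the derivative only in each fixed direction. Expanding the direction in
  the standard basis reduces all directions to finitely many, which is how the estimates below become
  uniform in the direction.
\<close>
lemma frechet_derivative_euclidean_expansion:
  fixes f :: "'a::euclidean_space \<Rightarrow> 'b::real_normed_vector"
  assumes "f differentiable (at x)"
  shows "frechet_derivative f (at x) v =
    (\<Sum>b\<in>Basis. (v \<bullet> b) *\<^sub>R frechet_derivative f (at x) b)"
proof -
  have lin: "linear (frechet_derivative f (at x))"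
    using assms by (rule linear_frechet_derivative)
  have "frechet_derivative f (at x) v =
      frechet_derivative f (at x) (\<Sum>b\<in>Basis. (v \<bullet> b) *\<^sub>R b)"
    by (simp add: euclidean_representation)
  then show ?thesis
    by (simp add: linear_sum[OF lin] linear_cmul[OF lin])
qed

lemma norm_sum_Basis_le:
  fixes v :: "'a::euclidean_space" and w :: "'a \<Rightarrow> 'b::real_normed_vector"
  assumes "\<And>b. b \<in> Basis \<Longrightarrow> norm (w b) \<le> M"
  shows "norm (\<Sum>b\<in>Basis. (v \<bullet> b) *\<^sub>R w b) \<le> real DIM('a) * M * norm v"
proof -
  have "norm (\<Sum>b\<in>Basis. (v \<bullet> b) *\<^sub>R w b) \<le> (\<Sum>b\<in>(Basis::'a set). norm v * M)"
    using assms by (intro sum_norm_le) (auto intro!: mult_mono Basis_le_norm)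
  then show ?thesis
    by (simp add: mult_ac)
qed

text \<open>
  There are finitely many basis vectors, so the least radius and the sum of the constants serve for
  all of them. This is used for local estimates on partial derivatives, where \<open>\<delta>\<close> is the radius of
  a ball and \<open>M\<close> the constant of the estimate.
\<close>
lemma uniform_over_Basis:
  fixes P :: "'a::euclidean_space \<Rightarrow> real \<Rightarrow> real \<Rightarrow> bool"
  assumes ex: "\<And>b. b \<in> Basis \<Longrightarrow> \<exists>\<delta>>0. \<exists>M\<ge>0. P b \<delta> M"
    and mono: "\<And>b \<delta> \<delta>' M M'. \<lbrakk>P b \<delta> M; 0 < \<delta>'; \<delta>' \<le> \<delta>; M \<le> M'\<rbrakk> \<Longrightarrow> P b \<delta>' M'"
  obtains \<delta> M where "\<delta> > 0" "M \<ge> 0" "\<And>b. b \<in> Basis \<Longrightarrow> P b \<delta> M"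
proof -
  obtain d m where dm: "\<And>b. b \<in> Basis \<Longrightarrow> d b > 0 \<and> m b \<ge> 0 \<and> P b (d b) (m b)"
    using ex by metis
  show thesis
  proof (rule that)
    show "Min (d ` Basis) > 0"
      using dm by simp
    show "(\<Sum>b\<in>Basis. m b) \<ge> 0"
      using dm by (simp add: sum_nonneg)
    show "P b (Min (d ` Basis)) (\<Sum>b\<in>Basis. m b)" if "b \<in> Basis" for b
    proof (rule mono[of b "d b" "m b"])
      show "m b \<le> (\<Sum>b\<in>Basis. m b)"
        using dm that by (intro member_le_sum) auto
    qed (use dm that in auto)
  qed
qed

section \<open>Local estimates for differentiable functions of several variables\<close>

text \<open>
  By continuity each partial derivative is bounded near \<open>a\<close>, so the derivative is bounded in operator
  norm there and the mean value inequality applies.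
\<close>
lemma C1_locally_lipschitz:
  fixes f :: "'a::euclidean_space \<Rightarrow> 'b::real_normed_vector"
  assumes "open S" "Ck_on 1 f S" "a \<in> S"
  obtains \<delta> L where "\<delta> > 0" "L \<ge> 0" "ball a \<delta> \<subseteq> S"
    "\<And>x y. x \<in> ball a \<delta> \<Longrightarrow> y \<in> ball a \<delta> \<Longrightarrow> norm (f x - f y) \<le> L * norm (x - y)"
proof -
  have diff: "f differentiable (at x)" if "x \<in> S" for x
    using assms that by simp
  have cont: "continuous_on S (\<lambda>x. frechet_derivative f (at x) b)" for b
    using assms by simp
  obtain \<delta>1 M where \<delta>1: "\<delta>1 > 0" "M \<ge> 0" and
    M: "\<And>b. b \<in> Basis \<Longrightarrow> \<forall>x\<in>ball a \<delta>1 \<inter> S. norm (frechet_derivative f (at x) b) \<le> M"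
  proof (rule uniform_over_Basis[of
        "\<lambda>b \<delta> M. \<forall>x\<in>ball a \<delta> \<inter> S. norm (frechet_derivative f (at x) b) \<le> M"])
    fix b :: 'a
    obtain d where "d > 0" and d: "\<And>x. x \<in> S \<Longrightarrow> dist x a < d \<Longrightarrow>
        dist (frechet_derivative f (at x) b) (frechet_derivative f (at a) b) < 1"
      using cont[of b] assms(3) unfolding continuous_on_iff by (metis zero_less_one)
    have "norm (frechet_derivative f (at x) b) \<le> norm (frechet_derivative f (at a) b) + 1"
      if "x \<in> ball a d \<inter> S" for x
      using d[of x] that norm_triangle_sub[of "frechet_derivative f (at x) b" "frechet_derivative f (at a) b"]
      by (simp add: dist_norm norm_minus_commute)
    then show "\<exists>\<delta>>0. \<exists>M\<ge>0. \<forall>x\<in>ball a \<delta> \<inter> S. norm (frechet_derivative f (at x) b) \<le> M"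
      using \<open>d > 0\<close> by (intro exI[of _ d] conjI exI[of _ "norm (frechet_derivative f (at a) b) + 1"]) auto
  next
    fix b :: 'a and \<delta> \<delta>' M M' :: real
    assume "\<forall>x\<in>ball a \<delta> \<inter> S. norm (frechet_derivative f (at x) b) \<le> M"
      "0 < \<delta>'" "\<delta>' \<le> \<delta>" "M \<le> M'"
    then show "\<forall>x\<in>ball a \<delta>' \<inter> S. norm (frechet_derivative f (at x) b) \<le> M'"
      by force
  qed (rule that)
  obtain \<delta>2 where \<delta>2: "\<delta>2 > 0" "ball a \<delta>2 \<subseteq> S"
    using assms openE by blast
  define \<delta> where "\<delta> = min \<delta>1 \<delta>2"
  have sub: "ball a \<delta> \<subseteq> S" "ball a \<delta> \<subseteq> ball a \<delta>1"
    using \<delta>2 by (auto simp: \<delta>_def)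
  show thesis
  proof (rule that[of \<delta> "real DIM('a) * M"])
    fix x y assume xy: "x \<in> ball a \<delta>" "y \<in> ball a \<delta>"
    show "norm (f x - f y) \<le> real DIM('a) * M * norm (x - y)"
    proof (rule differentiable_bound[of "ball a \<delta>" f "\<lambda>x. frechet_derivative f (at x)"])
      fix z assume z: "z \<in> ball a \<delta>"
      then have "f differentiable (at z)"
        using diff sub by blast
      then show "(f has_derivative frechet_derivative f (at z)) (at z within ball a \<delta>)"
        using frechet_derivative_works has_derivative_at_withinI by blast
      show "onorm (frechet_derivative f (at z)) \<le> real DIM('a) * M"
      proof (rule onorm_le)
        fix v
        show "norm (frechet_derivative f (at z) v) \<le> real DIM('a) * M * norm v"
          unfolding frechet_derivative_euclidean_expansion[OF \<open>f differentiable (at z)\<close>, of v]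
          using M z sub by (intro norm_sum_Basis_le) blast
      qed
    qed (use xy in auto)
  qed (use \<delta>1 \<delta>2 sub in \<open>auto simp: \<delta>_def\<close>)
qed

text \<open>
  The previous lemma applies to each partial derivative, and the basis expansion carries the Lipschitz
  bound over to the derivative in operator norm.
\<close>
lemma C2_derivative_locally_lipschitz:
  fixes f :: "'a::euclidean_space \<Rightarrow> 'b::real_normed_vector"
  assumes "open S" "Ck_on 2 f S" "a \<in> S"
  obtains \<delta> L where "\<delta> > 0" "L \<ge> 0" "ball a \<delta> \<subseteq> S"
    "\<And>x y v. x \<in> ball a \<delta> \<Longrightarrow> y \<in> ball a \<delta> \<Longrightarrow>
      norm (frechet_derivative f (at x) v - frechet_derivative f (at y) v)
        \<le> L * norm (x - y) * norm v"
proof -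
  have diff: "f differentiable (at x)" if "x \<in> S" for x
    using assms that by (simp add: numeral_2_eq_2)
  have C1: "Ck_on 1 (\<lambda>x. frechet_derivative f (at x) b) S" for b
    using assms by (simp add: numeral_2_eq_2)
  let ?P = "\<lambda>b \<delta> M. ball a \<delta> \<subseteq> S \<and> (\<forall>x\<in>ball a \<delta>. \<forall>y\<in>ball a \<delta>.
      norm (frechet_derivative f (at x) b - frechet_derivative f (at y) b) \<le> M * norm (x - y))"
  obtain \<delta> M where \<delta>: "\<delta> > 0" "M \<ge> 0" and M: "\<And>b. b \<in> Basis \<Longrightarrow> ?P b \<delta> M"
  proof (rule uniform_over_Basis[of ?P])
    fix b :: 'a
    show "\<exists>\<delta>>0. \<exists>M\<ge>0. ?P b \<delta> M"
      by (rule C1_locally_lipschitz[OF assms(1) C1[of b] assms(3)]) blast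
  next
    fix b \<delta> \<delta>' M M'
    assume P: "?P b \<delta> M" and "0 < \<delta>'" "\<delta>' \<le> \<delta>" and MM: "M \<le> M'"
    then have sub: "ball a \<delta>' \<subseteq> ball a \<delta>"
      by auto
    have "M * norm (x - y) \<le> M' * norm (x - y)" for x y :: 'a
      using MM by (intro mult_right_mono) auto
    then show "?P b \<delta>' M'"
      using P sub by (blast intro: order_trans)
  qed (rule that)
  have sub: "ball a \<delta> \<subseteq> S"
    using M SOME_Basis by blast
  show thesis
  proof (rule that[of \<delta> "real DIM('a) * M"])
    fix x y v assume xy: "x \<in> ball a \<delta>" "y \<in> ball a \<delta>"
    then have "f differentiable (at x)" "f differentiable (at y)"
      using diff sub by blast+
    then have "frechet_derivative f (at x) v - frechet_derivative f (at y) v =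
      (\<Sum>b\<in>Basis. (v \<bullet> b) *\<^sub>R (frechet_derivative f (at x) b - frechet_derivative f (at y) b))"
      by (subst (1 2) frechet_derivative_euclidean_expansion)
        (simp_all add: scaleR_diff_right sum_subtractf)
    moreover have "norm \<dots> \<le> real DIM('a) * (M * norm (x - y)) * norm v"
      using M xy by (intro norm_sum_Basis_le) blast
    ultimately show "norm (frechet_derivative f (at x) v - frechet_derivative f (at y) v)
        \<le> real DIM('a) * M * norm (x - y) * norm v"
      by (simp add: mult_ac)
  qed (use \<delta> sub in auto)
qed

text \<open>
  The linearisation is taken at the point \<open>x\<close>, as in Newton's method, and evaluated at \<open>a\<close>: for a
  root \<open>a\<close> the left-hand side is the norm of \<open>f'(x)\<close> applied to the error of the Newton iterate.
  The bound is the mean value inequality for \<open>z \<mapsto> f z - f'(x) z\<close> on the segment from \<open>a\<close> to \<open>x\<close>.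
\<close>
lemma newton_residual_quadratic:
  fixes f :: "'a::euclidean_space \<Rightarrow> 'b::real_normed_vector"
  assumes diff: "\<And>z. z \<in> B \<Longrightarrow> f differentiable (at z)"
    and lip: "\<And>z v. z \<in> B \<Longrightarrow>
      norm (frechet_derivative f (at z) v - frechet_derivative f (at x) v) \<le> L * norm (z - x) * norm v"
    and "convex B" "x \<in> B" "a \<in> B" "L \<ge> 0"
  shows "norm (f x - f a - frechet_derivative f (at x) (x - a)) \<le> L * norm (x - a) ^ 2"
proof -
  have sub: "closed_segment a x \<subseteq> B"
    using assms by (simp add: closed_segment_subset)
  have "norm (f x - f a - frechet_derivative f (at x) (x - a)) \<le> norm (x - a) * (L * norm (x - a))"
  proof (rule differentiable_bound_linearization[where S = "closed_segment a x"])
    show "a + t *\<^sub>R (x - a) \<in> closed_segment a x" if "t \<in> {0..1}" for t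
      using that by (auto simp: closed_segment_def algebra_simps intro!: exI[of _ t])
    show "(f has_derivative frechet_derivative f (at z)) (at z within closed_segment a x)"
      if "z \<in> closed_segment a x" for z
      using that sub diff frechet_derivative_works has_derivative_at_withinI by blast
    show "onorm (frechet_derivative f (at z) - frechet_derivative f (at x)) \<le> L * norm (x - a)"
      if z: "z \<in> closed_segment a x" for z
    proof (rule onorm_le)
      fix v :: 'a
      have "norm (z - x) \<le> norm (x - a)"
        using z by (metis dist_commute dist_in_closed_segment dist_norm)
      then have "L * norm (z - x) * norm v \<le> L * norm (x - a) * norm v"
        using \<open>L \<ge> 0\<close> by (intro mult_right_mono mult_left_mono) auto
      then show "norm ((frechet_derivative f (at z) - frechet_derivative f (at x)) v)
          \<le> L * norm (x - a) * norm v"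
        using lip[of z v] z sub by force
    qed
  qed auto
  then show ?thesis
    by (simp add: power2_eq_square mult_ac)
qed

text \<open>
  Let \<open>\<phi>\<close> be the error of the rule on the segment from \<open>a\<close> to \<open>a + t e\<close>. It vanishes at \<open>0\<close>. With
  \<open>g t = f'(a + t e) e\<close> its derivative is \<open>(g t - g 0 - t g' t) / 2\<close>, which is the residual
  estimated in \<open>newton_residual_quadratic\<close>, applied to the partial derivatives of \<open>f\<close>. The residual
  is quadratic in \<open>e\<close>, and \<open>g\<close> is itself linear in the direction \<open>e\<close>, whence the third order.
\<close>
lemma C3_trapezoidal_rule:
  fixes f :: "'a::euclidean_space \<Rightarrow> 'b::real_normed_vector"
  assumes "open S" "Ck_on 3 f S" "a \<in> S"
  obtains \<delta> M where "\<delta> > 0" "M \<ge> 0" "ball a \<delta> \<subseteq> S"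
    "\<And>x. x \<in> ball a \<delta> \<Longrightarrow>
      norm (f x - f a - (1/2) *\<^sub>R
        (frechet_derivative f (at x) (x - a) + frechet_derivative f (at a) (x - a)))
        \<le> M * norm (x - a) ^ 3"
proof -
  define h where "h b x = frechet_derivative f (at x) b" for b x
  define h' where "h' b x = frechet_derivative (h b) (at x)" for b x
  have diff: "f differentiable (at x)" if "x \<in> S" for x
    using assms that by (simp add: numeral_3_eq_3)
  have C2: "Ck_on 2 (h b) S" for b
    using assms by (simp add: numeral_3_eq_3 numeral_2_eq_2 h_def[abs_def])
  have diffh: "h b differentiable (at x)" if "x \<in> S" for b x
    using C2[of b] that by (simp add: numeral_2_eq_2)
  let ?P = "\<lambda>b \<delta> M. ball a \<delta> \<subseteq> S \<and>
      (\<forall>x\<in>ball a \<delta>. norm (h b x - h b a - h' b x (x - a)) \<le> M * norm (x - a) ^ 2)"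
  obtain \<delta> M where \<delta>: "\<delta> > 0" "M \<ge> 0" and M: "\<And>b. b \<in> Basis \<Longrightarrow> ?P b \<delta> M"
  proof (rule uniform_over_Basis[of ?P])
    fix b :: 'a
    obtain \<delta> L where \<delta>: "\<delta> > 0" "L \<ge> 0" "ball a \<delta> \<subseteq> S" and
      lip: "\<And>x y v. x \<in> ball a \<delta> \<Longrightarrow> y \<in> ball a \<delta> \<Longrightarrow>
        norm (h' b x v - h' b y v) \<le> L * norm (x - y) * norm v"
      by (rule C2_derivative_locally_lipschitz[OF assms(1) C2[of b] assms(3), folded h'_def])
        (rule that)
    have "norm (h b x - h b a - h' b x (x - a)) \<le> L * norm (x - a) ^ 2" if "x \<in> ball a \<delta>" for x
      unfolding h'_def using that \<delta> lip diffh
      by (intro newton_residual_quadratic[where B = "ball a \<delta>"]) (auto simp: h'_def)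
    then show "\<exists>\<delta>>0. \<exists>M\<ge>0. ?P b \<delta> M"
      using \<delta> by blast
  next
    fix b \<delta> \<delta>' M M'
    assume P: "?P b \<delta> M" and "0 < \<delta>'" "\<delta>' \<le> \<delta>" and MM: "M \<le> M'"
    then have sub: "ball a \<delta>' \<subseteq> ball a \<delta>"
      by auto
    have "M * norm (x - a) ^ 2 \<le> M' * norm (x - a) ^ 2" for x
      using MM by (intro mult_right_mono) auto
    then show "?P b \<delta>' M'"
      using P sub by (blast intro: order_trans)
  qed (rule that)
  have sub: "ball a \<delta> \<subseteq> S"
    using M SOME_Basis by blast
  show thesis
  proof (rule that[of \<delta> "real DIM('a) * M / 2"])
    fix x assume x: "x \<in> ball a \<delta>"
    define e where "e = x - a"
    define z where "z t = a + t *\<^sub>R e" for t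
    \<comment> \<open>The derivatives in direction \<open>e\<close> are written through the partial derivatives \<open>h b\<close>, so that
      the constant \<open>M\<close>, which is uniform in \<open>b\<close>, serves for every \<open>e\<close>.\<close>
    define \<phi> where "\<phi> t = f (z t) - f a - (t/2) *\<^sub>R (\<Sum>b\<in>Basis. (e \<bullet> b) *\<^sub>R (h b (z t) + h b a))" for t
    define \<phi>' where "\<phi>' t = (1/2) *\<^sub>R (\<Sum>b\<in>Basis. (e \<bullet> b) *\<^sub>R (h b (z t) - h b a - t *\<^sub>R h' b (z t) e))" for t
    have zS: "z t \<in> ball a \<delta>" if "t \<in> {0..1}" for t
    proof -
      have "norm (t *\<^sub>R e) \<le> 1 * norm e"
        using that by (simp add: mult_left_le_one_le)
      then show ?thesis
        using x by (simp add: z_def e_def dist_norm norm_minus_commute)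
    qed
    have expand: "frechet_derivative f (at y) e = (\<Sum>b\<in>Basis. (e \<bullet> b) *\<^sub>R h b y)" if "y \<in> S" for y
      unfolding h_def using diff[OF that] by (rule frechet_derivative_euclidean_expansion)
    have along: "((\<lambda>t. g (z t)) has_vector_derivative frechet_derivative g (at (z t)) e) (at t within {0..1})"
      if "g differentiable (at (z t))" for t and g :: "'a \<Rightarrow> 'b"
    proof -
      have "(z has_vector_derivative e) (at t within {0..1})"
        unfolding z_def by (auto intro!: derivative_eq_intros)
      moreover have "(g has_derivative frechet_derivative g (at (z t))) (at (z t) within z ` {0..1})"
        using that frechet_derivative_works has_derivative_at_withinI by blast
      ultimately show ?thesis
        using vector_derivative_diff_chain_within[of z e t "{0..1}" g] by (simp add: o_def)
    qed
    have der: "(\<phi> has_vector_derivative \<phi>' t) (at t within {0..1})" if t: "t \<in> {0..1}" for t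
    proof -
      have zt: "z t \<in> S"
        using zS[OF t] sub by blast
      have "(\<phi> has_vector_derivative frechet_derivative f (at (z t)) e - 0 -
          ((t/2) *\<^sub>R (\<Sum>b\<in>Basis. (e \<bullet> b) *\<^sub>R (h' b (z t) e + 0)) +
           (1/2) *\<^sub>R (\<Sum>b\<in>Basis. (e \<bullet> b) *\<^sub>R (h b (z t) + h b a)))) (at t within {0..1})"
        unfolding \<phi>_def h'_def
        by (intro has_vector_derivative_diff has_vector_derivative_scaleR has_vector_derivative_sum
            has_vector_derivative_add has_vector_derivative_const along diff diffh zt
            bounded_linear.has_vector_derivative[OF bounded_linear_scaleR_right])
          (auto intro!: derivative_eq_intros)
      moreover have "frechet_derivative f (at (z t)) e - 0 -
          ((t/2) *\<^sub>R (\<Sum>b\<in>Basis. (e \<bullet> b) *\<^sub>R (h' b (z t) e + 0)) +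
           (1/2) *\<^sub>R (\<Sum>b\<in>Basis. (e \<bullet> b) *\<^sub>R (h b (z t) + h b a))) = \<phi>' t"
      proof -
        have collect: "A - ((t/2) *\<^sub>R H + (1/2) *\<^sub>R (A + B)) = (1/2) *\<^sub>R (A - B - t *\<^sub>R H)" for A B H :: 'b
        proof -
          have "A - ((t/2) *\<^sub>R H + (1/2) *\<^sub>R (A + B))
              = (1 - 1/2) *\<^sub>R A - (1/2) *\<^sub>R B - (t/2) *\<^sub>R H"
            unfolding scaleR_left_diff_distrib by (simp add: scaleR_add_right)
          then show ?thesis
            by (simp add: scaleR_diff_right)
        qed
        show ?thesis
          using collect[of "\<Sum>b\<in>Basis. (e \<bullet> b) *\<^sub>R h b (z t)" "\<Sum>b\<in>Basis. (e \<bullet> b) *\<^sub>R h' b (z t) e"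
              "\<Sum>b\<in>Basis. (e \<bullet> b) *\<^sub>R h b a"]
          by (simp add: \<phi>'_def expand[OF zt] scaleR_diff_right scaleR_add_right sum.distrib
              sum_subtractf scaleR_sum_right mult_ac)
      qed
      ultimately show ?thesis
        by simp
    qed
    have bound: "norm (\<phi>' t) \<le> real DIM('a) * M / 2 * norm e ^ 3" if t: "t \<in> {0..1}" for t
    proof -
      have "norm (h b (z t) - h b a - t *\<^sub>R h' b (z t) e) \<le> M * norm e ^ 2" if b: "b \<in> Basis" for b
      proof -
        have lin: "linear (h' b (z t))"
          unfolding h'_def using zS[OF t] sub diffh by (intro linear_frechet_derivative) blast
        have "h' b (z t) (z t - a) = t *\<^sub>R h' b (z t) e"
          using linear_cmul[OF lin, of t e] by (simp add: z_def)
        then have "norm (h b (z t) - h b a - t *\<^sub>R h' b (z t) e) \<le> M * norm (t *\<^sub>R e) ^ 2"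
          using M[OF b] zS[OF t] by (metis z_def add_diff_cancel_left')
        also have "\<dots> \<le> M * norm e ^ 2"
          using t \<delta> by (intro mult_left_mono power_mono) (auto simp: mult_left_le_one_le)
        finally show ?thesis .
      qed
      then have "norm (\<Sum>b\<in>Basis. (e \<bullet> b) *\<^sub>R (h b (z t) - h b a - t *\<^sub>R h' b (z t) e))
          \<le> real DIM('a) * (M * norm e ^ 2) * norm e"
        by (rule norm_sum_Basis_le)
      then show ?thesis
        by (simp add: \<phi>'_def power2_eq_square power3_eq_cube mult_ac)
    qed
    have "norm (\<phi> 1 - \<phi> 0) \<le> (real DIM('a) * M / 2 * norm e ^ 3) * norm (1 - 0 :: real)"
    proof (rule differentiable_bound[of "{0..1}" \<phi> "\<lambda>t s. s *\<^sub>R \<phi>' t"])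
      show "(\<phi> has_derivative (\<lambda>s. s *\<^sub>R \<phi>' t)) (at t within {0..1})" if "t \<in> {0..1}" for t
        using der[OF that] by (simp add: has_vector_derivative_def)
      show "onorm (\<lambda>s. s *\<^sub>R \<phi>' t) \<le> real DIM('a) * M / 2 * norm e ^ 3" if "t \<in> {0..1}" for t
      proof (rule onorm_le)
        fix s :: real
        show "norm (s *\<^sub>R \<phi>' t) \<le> real DIM('a) * M / 2 * norm e ^ 3 * norm s"
          using mult_left_mono[OF bound[OF that] abs_ge_zero[of s]] by (simp add: mult_ac)
      qed
    qed auto
    moreover have "\<phi> 0 = 0" and "z 1 = x"
      by (simp_all add: \<phi>_def z_def e_def)
    moreover have "\<phi> 1 = f x - f a - (1/2) *\<^sub>R
        (frechet_derivative f (at x) e + frechet_derivative f (at a) e)"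
      using x sub assms(3) expand[of x] expand[of a] \<open>z 1 = x\<close>
      by (simp add: \<phi>_def scaleR_add_right sum.distrib subset_iff)
    ultimately show "norm (f x - f a - (1/2) *\<^sub>R
        (frechet_derivative f (at x) (x - a) + frechet_derivative f (at a) (x - a)))
        \<le> real DIM('a) * M / 2 * norm (x - a) ^ 3"
      by (simp add: e_def)
  qed (use \<delta> sub in auto)
qed

section \<open>One step of the iteration\<close>

lemma invertible_matrix_inv_vector:
  fixes A :: "real ^ 'n ^ 'n"
  assumes "invertible A"
  shows "A *v (matrix_inv A *v v) = v"
proof -
  have "A ** matrix_inv A = mat 1"
    using someI_ex[OF assms[unfolded invertible_def]] by (simp add: matrix_inv_def)
  then show ?thesis
    by (simp add: matrix_vector_mul_assoc)
qed

text \<open>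
  Here and in the next lemma \<open>e\<close> is the error of the current iterate and \<open>Fx\<close> the value of the
  function there. Lower bounds on the matrix replace bounds on its inverse.
\<close>
lemma newton_step_error:
  fixes J :: "real ^ 'n ^ 'n" and e Fx :: "real ^ 'n"
  assumes inv: "invertible J"
    and below: "\<And>v. c * norm v \<le> norm (J *v v)" and "c > 0"
    and res: "norm (Fx - J *v e) \<le> L * norm e ^ 2"
  shows "norm (e - matrix_inv J *v Fx) \<le> L / c * norm e ^ 2"
proof -
  have "J *v (e - matrix_inv J *v Fx) = - (Fx - J *v e)"
    by (simp add: matrix_vector_mult_diff_distrib invertible_matrix_inv_vector[OF inv])
  then have "norm (J *v (e - matrix_inv J *v Fx)) \<le> L * norm e ^ 2"
    using res by (simp only: norm_minus_cancel)
  then have "c * norm (e - matrix_inv J *v Fx) \<le> L * norm e ^ 2"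
    by (rule order_trans[OF below])
  then show ?thesis
    using \<open>c > 0\<close> by (simp add: field_simps)
qed

text \<open>
  The hypotheses are the local estimates at one step: \<open>Ja\<close>, \<open>Jx\<close> and \<open>Jy\<close> are the Jacobians at the
  root, at the current iterate and at its Newton iterate, whose error is \<open>e - u\<close>. The step
  \<open>split\<close> is the identity that exhibits the error as a sum of third-order terms.
\<close>
lemma corrected_step_error:
  fixes Ja Jx Jy :: "real ^ 'n ^ 'n" and e Fx :: "real ^ 'n"
  defines "u \<equiv> matrix_inv Jx *v Fx"
  assumes inv: "invertible Jx"
    and below: "\<And>v. c * norm v \<le> norm (Jx *v v)" and "c > 0"
    and newton: "norm (e - u) \<le> K * norm e ^ 2" and small: "norm (e - u) \<le> norm e"
    and trap: "norm (Fx - (1/2) *\<^sub>R (Jx *v e + Ja *v e)) \<le> M * norm e ^ 3"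
    and lipx: "\<And>v. norm (Jx *v v - Ja *v v) \<le> L * norm e * norm v"
    and lipy: "\<And>v. norm (Jy *v v - Ja *v v) \<le> L * norm (e - u) * norm v"
    and "L \<ge> 0" "K \<ge> 0"
  shows "norm (e - (1/2) *\<^sub>R ((3 *\<^sub>R mat 1 - matrix_inv Jx ** Jy) *v u))
      \<le> (M + 3/2 * L * K) / c * norm e ^ 3"
proof -
  let ?w = "e - (1/2) *\<^sub>R ((3 *\<^sub>R mat 1 - matrix_inv Jx ** Jy) *v u)"
  have Ju: "Jx *v u = Fx"
    by (simp add: u_def invertible_matrix_inv_vector[OF inv])
  have "(3 *\<^sub>R mat 1 - matrix_inv Jx ** Jy) *v u = 3 *\<^sub>R u - matrix_inv Jx *v (Jy *v u)"
    by (simp add: matrix_vector_mult_diff_rdistrib matrix_vector_mul_assoc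
        flip: scaleR_matrix_vector_assoc)
  then have "Jx *v ?w = Jx *v e - (1/2) *\<^sub>R (3 *\<^sub>R Fx - Jy *v u)"
    by (simp add: matrix_vector_mult_diff_distrib matrix_vector_mult_scaleR Ju
        invertible_matrix_inv_vector[OF inv])
  also have "\<dots> = - (Fx - (1/2) *\<^sub>R (Jx *v e + Ja *v e))
      + (1/2) *\<^sub>R ((Jx *v (e - u) - Ja *v (e - u)) + (Jy *v u - Ja *v u))"
    by (simp add: vec_eq_iff matrix_vector_mult_diff_distrib Ju field_simps)
  finally have split: "Jx *v ?w = \<dots>" .
  have "norm (Jx *v (e - u) - Ja *v (e - u)) \<le> L * norm e * (K * norm e ^ 2)"
    using lipx[of "e - u"] newton \<open>L \<ge> 0\<close>
    by (meson mult_left_mono mult_nonneg_nonneg norm_ge_zero order_trans)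
  moreover have "norm (Jy *v u - Ja *v u) \<le> L * (K * norm e ^ 2) * (2 * norm e)"
  proof -
    have "norm u \<le> 2 * norm e"
      using small norm_triangle_sub[of u e] by (simp add: norm_minus_commute)
    then show ?thesis
      using lipy[of u] newton \<open>L \<ge> 0\<close> \<open>K \<ge> 0\<close>
      by (elim order_trans) (intro mult_mono mult_nonneg_nonneg, auto)
  qed
  ultimately have "norm (Jx *v ?w) \<le> M * norm e ^ 3
      + 1/2 * (L * norm e * (K * norm e ^ 2) + L * (K * norm e ^ 2) * (2 * norm e))"
    unfolding split using trap
    by (intro norm_triangle_le add_mono)
      (simp_all only: norm_minus_cancel norm_scaleR, intro mult_mono norm_triangle_le add_mono, auto)
  also have "\<dots> = (M + 3/2 * L * K) * norm e ^ 3"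
    by (simp add: algebra_simps power2_eq_square power3_eq_cube)
  finally have "c * norm ?w \<le> (M + 3/2 * L * K) * norm e ^ 3"
    using below[of ?w] by linarith
  then show ?thesis
    using \<open>c > 0\<close> by (simp add: field_simps)
qed

section \<open>Local convergence\<close>

text \<open>
  If \<open>J a\<close> stretches every vector by at least \<open>c\<close>, then so does \<open>J x\<close> with \<open>c/2\<close> as soon as the
  perturbation \<open>J x - J a\<close> has operator norm at most \<open>c/2\<close>.
\<close>
lemma invertible_locally_bounded_below:
  fixes J :: "'a::real_normed_vector \<Rightarrow> real ^ 'n ^ 'n"
  assumes inv: "invertible (J a)" and "\<delta> > 0" "L \<ge> 0"
    and lip: "\<And>x v. x \<in> ball a \<delta> \<Longrightarrow> norm (J x *v v - J a *v v) \<le> L * norm (x - a) * norm v"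
  obtains r c where "0 < r" "r \<le> \<delta>" "c > 0"
    "\<And>x v. x \<in> ball a r \<Longrightarrow> c * norm v \<le> norm (J x *v v)"
proof -
  have "inj ((*v) (J a))"
    using inv by (simp add: invertible_left_inverse matrix_left_invertible_injective)
  then obtain c where "c > 0" and c: "\<And>v. c * norm v \<le> norm (J a *v v)"
    using linear_inj_bounded_below_pos[OF matrix_vector_mul_linear] by blast
  \<comment> \<open>\<open>L + 1\<close> in place of \<open>L\<close> keeps the quotient meaningful for \<open>L = 0\<close>.\<close>
  define r where "r = min \<delta> (c / (2 * (L + 1)))"
  show thesis
  proof (rule that[of r "c/2"])
    fix x and v :: "real ^ 'n"
    assume x: "x \<in> ball a r"
    then have n: "norm (x - a) < c / (2 * (L + 1))"
      by (simp add: r_def dist_norm norm_minus_commute)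
    have "L * norm (x - a) \<le> (L + 1) * (c / (2 * (L + 1)))"
      using n \<open>L \<ge> 0\<close> by (intro mult_mono) auto
    also have "\<dots> = c / 2"
      using \<open>L \<ge> 0\<close> by (simp add: field_simps)
    finally have "L * norm (x - a) * norm v \<le> c / 2 * norm v"
      by (rule mult_right_mono) simp
    then have "norm (J x *v v - J a *v v) \<le> c / 2 * norm v"
      using lip[of x v] x by (simp add: r_def)
    then show "c / 2 * norm v \<le> norm (J x *v v)"
      using c[of v] norm_triangle_sub[of "J a *v v" "J x *v v"] by (simp add: norm_minus_commute)
  qed (use \<open>\<delta> > 0\<close> \<open>c > 0\<close> \<open>L \<ge> 0\<close> in \<open>auto simp: r_def\<close>)
qed

text \<open>
  The smallness condition says that a cubic step at least halves the error within the ball. Therefore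
  the ball is never left, and the cubic bound holds at every step.
\<close>
lemma cubic_contraction_converges:
  fixes X :: "nat \<Rightarrow> 'a::real_normed_vector"
  assumes start: "X 0 \<in> ball a r"
    and step: "\<And>k. X k \<in> ball a r \<Longrightarrow> norm (X (Suc k) - a) \<le> C * norm (X k - a) ^ 3"
    and "r > 0" "C \<ge> 0" and small: "C * r ^ 2 \<le> 1/2"
  shows "X k \<in> ball a r" and "converges_with_order X a 3"
proof -
  have half: "norm (X (Suc k) - a) \<le> 1/2 * norm (X k - a)" if "X k \<in> ball a r" for k
  proof -
    have "C * norm (X k - a) ^ 2 \<le> C * r ^ 2"
      using that \<open>C \<ge> 0\<close> by (intro mult_left_mono power_mono) (auto simp: dist_norm norm_minus_commute)
    then have "C * norm (X k - a) ^ 2 * norm (X k - a) \<le> 1/2 * norm (X k - a)"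
      using small by (intro mult_right_mono) auto
    then show ?thesis
      using step[OF that] by (simp add: power2_eq_square power3_eq_cube mult_ac)
  qed
  have inball: "X k \<in> ball a r" for k
  proof (induction k)
    case (Suc k)
    then show ?case
      using half[OF Suc] norm_ge_zero[of "X k - a"]
      by (simp add: dist_norm norm_minus_commute del: norm_ge_zero)
  qed (use start in auto)
  then show "X k \<in> ball a r" .
  have geo: "norm (X k - a) \<le> (1/2) ^ k * norm (X 0 - a)" for k
  proof (induction k)
    case (Suc k)
    then show ?case
      using half[OF inball[of k]] by simp
  qed simp
  have "(\<lambda>k. (1/2) ^ k * norm (X 0 - a)) \<longlonglongrightarrow> 0 * norm (X 0 - a)"
    by (intro tendsto_mult LIMSEQ_power_zero tendsto_const) auto
  then have "(\<lambda>k. X k - a) \<longlonglongrightarrow> 0"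
    by (intro Lim_null_comparison[OF always_eventually[OF allI[OF geo]]]) simp
  then have "X \<longlonglongrightarrow> a"
    by (simp add: LIM_zero_iff)
  then show "converges_with_order X a 3"
    unfolding converges_with_order_def using step inball by blast
qed

theorem theorem2p1:
  fixes F :: "real ^ 'n \<Rightarrow> real ^ 'n"
    and D :: "(real ^ 'n) set"
    and \<alpha> :: "real ^ 'n"
  assumes "open D" and "convex D"
    and "Ck_on 6 F D"
    and "\<alpha> \<in> D" and "F \<alpha> = 0"
    and "continuous_on D (\<lambda>x. jacobian F (at x))"
    and "\<And>x. x \<in> D \<Longrightarrow> invertible (jacobian F (at x))"
  shows "\<exists>U. open U \<and> \<alpha> \<in> U \<and> U \<subseteq> D \<and>
    (\<forall>X Y :: nat \<Rightarrow> real ^ 'n.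
       X 0 \<in> U \<and>
       (\<forall>k. Y k = X k - matrix_inv (jacobian F (at (X k))) *v F (X k)) \<and>
       (\<forall>k. X (Suc k) = X k - (1/2) *\<^sub>R
          ((3 *\<^sub>R mat 1 - matrix_inv (jacobian F (at (X k))) ** jacobian F (at (Y k)))
             *v (matrix_inv (jacobian F (at (X k))) *v F (X k))))
       \<longrightarrow> (\<forall>k. X k \<in> D \<and> Y k \<in> D) \<and> converges_with_order X \<alpha> 3)"
proof -
  define J where "J x = jacobian F (at x)" for x
  have smooth: "Ck_on 2 F D" "Ck_on 3 F D"
    by (rule Ck_on_antimono[OF _ assms(3)]; simp)+
  have diff: "F differentiable (at x)" if "x \<in> D" for x
    using smooth(1) that by (simp add: numeral_2_eq_2)
  have deriv: "frechet_derivative F (at x) v = J x *v v" if "x \<in> D" for x v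
    using frechet_derivative_at[OF diff[OF that, unfolded jacobian_works]] 
    by (simp add: J_def fun_eq_iff)
  obtain \<delta>1 L where \<delta>1: "\<delta>1 > 0" "ball \<alpha> \<delta>1 \<subseteq> D" and "L \<ge> 0" and
    lip': "\<And>x y v. x \<in> ball \<alpha> \<delta>1 \<Longrightarrow> y \<in> ball \<alpha> \<delta>1 \<Longrightarrow>
      norm (frechet_derivative F (at x) v - frechet_derivative F (at y) v)
        \<le> L * norm (x - y) * norm v"
    by (rule C2_derivative_locally_lipschitz[OF assms(1) smooth(1) assms(4)]) (rule that)
  obtain \<delta>2 M where \<delta>2: "\<delta>2 > 0" and "M \<ge> 0" and
    trap': "\<And>x. x \<in> ball \<alpha> \<delta>2 \<Longrightarrow> norm (F x - F \<alpha> - (1/2) *\<^sub>R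
        (frechet_derivative F (at x) (x - \<alpha>) + frechet_derivative F (at \<alpha>) (x - \<alpha>)))
        \<le> M * norm (x - \<alpha>) ^ 3"
    by (rule C3_trapezoidal_rule[OF assms(1) smooth(2) assms(4)]) (rule that)
  have lip: "norm (J x *v v - J \<alpha> *v v) \<le> L * norm (x - \<alpha>) * norm v" if "x \<in> ball \<alpha> \<delta>1" for x v
    using lip'[OF that, of \<alpha> v] \<delta>1 that assms(4) by (simp add: deriv subset_iff)
  have inv: "invertible (J x)" if "x \<in> D" for x
    unfolding J_def using assms(7) that .
  obtain \<delta>3 c where \<delta>3: "0 < \<delta>3" "\<delta>3 \<le> \<delta>1" and "c > 0" and
    below: "\<And>x v. x \<in> ball \<alpha> \<delta>3 \<Longrightarrow> c * norm v \<le> norm (J x *v v)"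
    by (rule invertible_locally_bounded_below[where J = J, OF inv[OF assms(4)] \<delta>1(1) \<open>L \<ge> 0\<close> lip])
      (assumption, rule that)
  define K where "K = L / c"
  define C where "C = (M + 3/2 * L * K) / c"
  have "K \<ge> 0"
    using \<open>L \<ge> 0\<close> \<open>c > 0\<close> by (simp add: K_def)
  then have "C \<ge> 0"
    using \<open>L \<ge> 0\<close> \<open>M \<ge> 0\<close> \<open>c > 0\<close> by (simp add: C_def)
  \<comment> \<open>The fourth bound gives \<open>K r \<le> 1\<close>, which keeps the Newton iterate in the ball. The bounds
    \<open>1\<close> and \<open>1 / (2 (C + 1))\<close> together give \<open>C r\<^sup>2 \<le> 1/2\<close>, which keeps the next iterate there.\<close>
  define r where "r = Min {\<delta>2, \<delta>3, 1, 1 / (K + 1), 1 / (2 * (C + 1))}"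
  have r: "0 < r" "r \<le> \<delta>2" "r \<le> \<delta>3" "r \<le> 1" "r \<le> 1 / (K + 1)" "r \<le> 1 / (2 * (C + 1))"
    using \<delta>2 \<delta>3 \<open>K \<ge> 0\<close> \<open>C \<ge> 0\<close> by (simp_all add: r_def)
  have Kr: "K * r \<le> 1"
    using r(5) \<open>K \<ge> 0\<close> r(1) by (simp add: field_simps)
  have Cr: "C * r ^ 2 \<le> 1/2"
  proof -
    have "C * r \<le> 1/2"
      using r(6) \<open>C \<ge> 0\<close> r(1) by (simp add: field_simps)
    moreover have "C * r ^ 2 \<le> C * r"
      using r \<open>C \<ge> 0\<close> by (intro mult_left_mono) (auto simp: power2_eq_square mult_left_le)
    ultimately show ?thesis by simp
  qed
  have sub: "ball \<alpha> r \<subseteq> D" "ball \<alpha> r \<subseteq> ball \<alpha> \<delta>1"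
    using r \<delta>3 \<delta>1 by auto
  have y_error: "norm ((x - \<alpha>) - matrix_inv (J x) *v F x) \<le> K * norm (x - \<alpha>) ^ 2"
    and y_small: "norm ((x - \<alpha>) - matrix_inv (J x) *v F x) \<le> norm (x - \<alpha>)"
    if x: "x \<in> ball \<alpha> r" for x
  proof -
    have "norm (F x - F \<alpha> - frechet_derivative F (at x) (x - \<alpha>)) \<le> L * norm (x - \<alpha>) ^ 2"
      using x sub lip' diff \<open>L \<ge> 0\<close> r(1)
      by (intro newton_residual_quadratic[where B = "ball \<alpha> r"]) (auto simp: subset_iff)
    then have "norm (F x - J x *v (x - \<alpha>)) \<le> L * norm (x - \<alpha>) ^ 2"
      using x sub deriv assms(5) by (simp add: subset_iff)
    then show quad: "norm ((x - \<alpha>) - matrix_inv (J x) *v F x) \<le> K * norm (x - \<alpha>) ^ 2"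
      unfolding K_def using x sub r below assms(7) \<open>c > 0\<close>
      by (intro newton_step_error) (auto simp: J_def)
    have "K * norm (x - \<alpha>) \<le> K * r"
      using x \<open>K \<ge> 0\<close> by (intro mult_left_mono) (auto simp: dist_norm norm_minus_commute)
    then have "K * norm (x - \<alpha>) * norm (x - \<alpha>) \<le> 1 * norm (x - \<alpha>)"
      using Kr by (intro mult_right_mono) auto
    then show "norm ((x - \<alpha>) - matrix_inv (J x) *v F x) \<le> norm (x - \<alpha>)"
      using quad by (simp add: power2_eq_square mult_ac)
  qed
  have y_ball: "x - matrix_inv (J x) *v F x \<in> ball \<alpha> r" if x: "x \<in> ball \<alpha> r" for x
    using y_small[OF x] x by (simp add: dist_norm norm_minus_commute algebra_simps)
  have step: "norm (x - (1/2) *\<^sub>R ((3 *\<^sub>R mat 1 - matrix_inv (J x) ** J y) *v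
        (matrix_inv (J x) *v F x)) - \<alpha>) \<le> C * norm (x - \<alpha>) ^ 3"
    if x: "x \<in> ball \<alpha> r" and y: "y = x - matrix_inv (J x) *v F x" for x y
  proof -
    have yb: "y \<in> ball \<alpha> \<delta>1"
      using y_ball[OF x] y sub by blast
    have ya: "y - \<alpha> = (x - \<alpha>) - matrix_inv (J x) *v F x"
      by (simp add: y)
    have "norm ((x - \<alpha>) - (1/2) *\<^sub>R ((3 *\<^sub>R mat 1 - matrix_inv (J x) ** J y) *v
        (matrix_inv (J x) *v F x))) \<le> C * norm (x - \<alpha>) ^ 3"
      unfolding C_def
    proof (rule corrected_step_error[where Ja = "J \<alpha>"])
      show "invertible (J x)"
        using x sub assms(7) by (auto simp: J_def)
      show "c * norm v \<le> norm (J x *v v)" for v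
        using below x r by auto
      show "norm (F x - (1/2) *\<^sub>R (J x *v (x - \<alpha>) + J \<alpha> *v (x - \<alpha>))) \<le> M * norm (x - \<alpha>) ^ 3"
        using trap'[of x] x r sub deriv[of x] deriv[of \<alpha>] assms(4,5) by (simp add: subset_iff)
      show "norm (J x *v v - J \<alpha> *v v) \<le> L * norm (x - \<alpha>) * norm v" for v
        using lip x sub by blast
      show "norm (J y *v v - J \<alpha> *v v)
          \<le> L * norm (x - \<alpha> - matrix_inv (J x) *v F x) * norm v" for v
        using lip[OF yb, of v] unfolding ya .
    qed (use y_error[OF x] y_small[OF x] \<open>c > 0\<close> \<open>L \<ge> 0\<close> \<open>K \<ge> 0\<close> in auto)
    then show ?thesis
      by (simp add: algebra_simps)
  qed
  show ?thesis
  proof (intro exI[of _ "ball \<alpha> r"] conjI allI impI; (elim conjE)?)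
    fix X Y :: "nat \<Rightarrow> real ^ 'n"
    assume X0: "X 0 \<in> ball \<alpha> r"
      and Y: "\<forall>k. Y k = X k - matrix_inv (jacobian F (at (X k))) *v F (X k)"
      and X: "\<forall>k. X (Suc k) = X k - (1/2) *\<^sub>R
          ((3 *\<^sub>R mat 1 - matrix_inv (jacobian F (at (X k))) ** jacobian F (at (Y k)))
             *v (matrix_inv (jacobian F (at (X k))) *v F (X k)))"
    have contr: "norm (X (Suc k) - \<alpha>) \<le> C * norm (X k - \<alpha>) ^ 3" if "X k \<in> ball \<alpha> r" for k
      using step[OF that, of "Y k"] Y X by (simp add: J_def)
    note conv = cubic_contraction_converges[OF X0 contr r(1) \<open>C \<ge> 0\<close> Cr]
    show "X k \<in> D" for k
      using conv(1) sub by blast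
    show "Y k \<in> D" for k
      using y_ball[OF conv(1), of k] sub Y by (auto simp: J_def)
    show "converges_with_order X \<alpha> 3"
      by (rule conv(2))
  qed (use r(1) sub in auto)
qed

end
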